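(* Let $n,m,q\in\mathbb{N}$ with $m\le n$ and $m\le q\le 2m-2$, let $\gamma=(\gamma_1,\ldots,\gamma_{m-1})\in\mathbb{R}^{m-1}$, and consider $$\mathrm{P}_{nmq}:\quad \min\ \sum_{i=1}^n x_i^q\quad\text{s.t. } x\in\mathbb{R}^n,\ \sum_{i=1}^n x_i^j=\gamma_j,\quad j=1,\ldots,m-1,$$ with optimal value $\min\mathrm{P}_{nmq}$. Let $$\mathrm{U}_{nmq}=\min_{p_0\in\mathbb{R}}\{\,Q_q(p_0)\ :\ H_m(s)\succeq0\,\}$$ be the one-variable semidefinite program in which $s_0=m$, $s_j=\gamma_j$ for $1\le j\le m-1$, and $s_j=Q_j(p_0)$ for $m\le j\le 2m-2$, with the affine functions $Q_j$ defined in the context. Then $\min\mathrm{P}_{nmq}\le\mathrm{U}_{nmq}$. In addition, if $\mathrm{P}_{nmq}$ has an optimal solution $x^*\in\mathbb{R}^n$ with at most $m$ non-zero entries, then $\min\mathrm{P}_{nmq}=\mathrm{U}_{nmq}$, and so $\mathrm{P}_{nmq}$ has the equivalent convex formulation given by the semidefinite program defining $\mathrm{U}_{nmq}$.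
   Context: $H_m(s)=(s_{i+j-2})_{1\le i,j\le m}$ is the Hankel matrix; $\succeq0$ means positive semidefinite. Optimal values are understood as infima (with $+\infty$ for infeasible problems). Definition of $Q_j$: For a monic polynomial $p=X^m+\sum_{j=0}^{m-1}p_jX^j\in\mathbb{R}[X]$ with roots $x_1,\ldots,x_m\in\mathbb{C}$ (with multiplicity), its Newton sums are $s_k=\sum_{j=1}^m x_j^k$, $k\ge0$. They satisfy Newton's identities $s_k+p_{m-1}s_{k-1}+\cdots+p_{m-k+1}s_1=-kp_{m-k}$ for $1\le k<m$ and $s_k+p_{m-1}s_{k-1}+\cdots+p_0s_{k-m}=0$ for $k\ge m$. Prescribing $s_j=\gamma_j$ for $1\le j\le m-1$ determines $p_1,\ldots,p_{m-1}$ through the first set of identities, leaving $p_0$ as the only unknown; for $j\ge m$ the Newton sum $s_j$ is then a polynomial $Q_j(p_0)$ in $p_0$, which is affine whenever $m\le j\le 2m-1$. *)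

theory Defs
  imports
    "HOL-Analysis.Convex"
    "HOL-Library.Extended_Real"
    "HOL-Computational_Algebra.Computational_Algebra"
    "Jordan_Normal_Form.Matrix"
begin

text \<open>
  Points of $\mathbb{R}^n$ are elements of \<^term>\<open>carrier_vec n :: real vec set\<close>, so vector and
  matrix indices start at 0.  A vector $\gamma \in \mathbb{R}^{m-1}$ is a function on
  \<^typ>\<open>nat\<close> of which only the values at $1,\ldots,m-1$ are ever used.
\<close>

text \<open>The Newton sum $s_k$ of \<open>p\<close>, over its complex roots counted with multiplicity. It is a real
  number because the non-real roots come in conjugate pairs, so taking the real part only
  changes the type.\<close>

definition newton_sum :: "real poly \<Rightarrow> nat \<Rightarrow> real" where
  "newton_sum p k = Re (\<Sum>x\<in>#proots (map_poly complex_of_real p). x ^ k)"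

text \<open>\<open>newton_coeff \<gamma> k\<close> is the coefficient $p_{m-k}$ obtained by solving Newton's identity
  number $k$ for $p_{m-k}$, where $1 \le k < m$ and $s_j = \gamma_j$. The value 1 at \<open>k = 0\<close> is
  the leading coefficient; it contributes the summand $s_k$ of the identity.\<close>

fun newton_coeff :: "(nat \<Rightarrow> real) \<Rightarrow> nat \<Rightarrow> real" where
  "newton_coeff \<gamma> k =
     (if k = 0 then 1 else - (\<Sum>i<k. newton_coeff \<gamma> i * \<gamma> (k - i)) / real k)"

declare newton_coeff.simps [simp del]

definition newton_poly :: "nat \<Rightarrow> (nat \<Rightarrow> real) \<Rightarrow> real \<Rightarrow> real poly" where
  "newton_poly m \<gamma> p0 =
     monom 1 m + (\<Sum>j=1..<m. monom (newton_coeff \<gamma> (m - j)) j) + [:p0:]"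

lemma coeff_newton_poly:
  assumes "m \<ge> 1"
  shows "coeff (newton_poly m \<gamma> p0) j =
    (if j = m then 1 else if j = 0 then p0
     else if j < m then newton_coeff \<gamma> (m - j) else 0)"
proof -
  have "coeff (\<Sum>i=1..<m. monom (newton_coeff \<gamma> (m - i)) i) j =
      (\<Sum>i=1..<m. if i = j then newton_coeff \<gamma> (m - i) else 0)"
    by (simp add: coeff_sum)
  also have "\<dots> = (if 1 \<le> j \<and> j < m then newton_coeff \<gamma> (m - j) else 0)"
    by (subst sum.delta) auto
  finally show ?thesis
    using assms by (auto simp: newton_poly_def coeff_pCons split: nat.splits)
qed

lemma newton_poly_monic:
  assumes "m \<ge> 1"
  shows "degree (newton_poly m \<gamma> p0) = m" and "lead_coeff (newton_poly m \<gamma> p0) = 1"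
proof -
  show "degree (newton_poly m \<gamma> p0) = m"
    by (intro order_antisym degree_le le_degree) (use assms in \<open>auto simp: coeff_newton_poly\<close>)
  thus "lead_coeff (newton_poly m \<gamma> p0) = 1"
    using assms by (simp add: coeff_newton_poly)
qed

lemma newton_poly_newton_identity:
  fixes \<gamma> :: "nat \<Rightarrow> real" and p0 :: real
  assumes "1 \<le> k" "k < m"
  defines "p \<equiv> newton_poly m \<gamma> p0"
  shows "\<gamma> k + (\<Sum>i=1..<k. coeff p (m - i) * \<gamma> (k - i)) = - real k * coeff p (m - k)"
proof -
  have "(\<Sum>i<k. newton_coeff \<gamma> i * \<gamma> (k - i))
      = \<gamma> k + (\<Sum>i=1..<k. newton_coeff \<gamma> i * \<gamma> (k - i))"
    using assms(1)
    by (simp add: lessThan_atLeast0 sum.atLeast_Suc_lessThan newton_coeff.simps[of _ 0])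
  also have "(\<Sum>i=1..<k. newton_coeff \<gamma> i * \<gamma> (k - i))
      = (\<Sum>i=1..<k. coeff p (m - i) * \<gamma> (k - i))"
    using assms(2) by (intro sum.cong) (auto simp: p_def coeff_newton_poly)
  finally have "(\<Sum>i<k. newton_coeff \<gamma> i * \<gamma> (k - i))
      = \<gamma> k + (\<Sum>i=1..<k. coeff p (m - i) * \<gamma> (k - i))" .
  moreover have "coeff p (m - k) = newton_coeff \<gamma> k"
    using assms(1,2) by (auto simp: p_def coeff_newton_poly)
  ultimately show ?thesis
    using assms(1) by (simp add: newton_coeff.simps[of \<gamma> k])
qed

definition Q :: "nat \<Rightarrow> (nat \<Rightarrow> real) \<Rightarrow> nat \<Rightarrow> real \<Rightarrow> real" where
  "Q m \<gamma> j p0 = newton_sum (newton_poly m \<gamma> p0) j"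

definition hankel_mat :: "nat \<Rightarrow> (nat \<Rightarrow> real) \<Rightarrow> real mat" where
  "hankel_mat m s = mat m m (\<lambda>(i, j). s (i + j))"

definition psd :: "real mat \<Rightarrow> bool" where
  "psd A \<longleftrightarrow> square_mat A \<and> transpose_mat A = A \<and>
     (\<forall>v \<in> carrier_vec (dim_row A). v \<bullet> (A *\<^sub>v v) \<ge> 0)"

text \<open>Optimal values lie in the extended reals, where the infimum of the empty set is \<open>\<infinity>\<close>.\<close>

definition opt_value :: "('a \<Rightarrow> real) \<Rightarrow> 'a set \<Rightarrow> ereal" where
  "opt_value f F = (INF x\<in>F. ereal (f x))"

definition is_optimal_solution :: "('a \<Rightarrow> real) \<Rightarrow> 'a set \<Rightarrow> 'a \<Rightarrow> bool" where
  "is_optimal_solution f F x \<longleftrightarrow> x \<in> F \<and> (\<forall>y\<in>F. f x \<le> f y)"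

definition power_sum :: "nat \<Rightarrow> nat \<Rightarrow> real vec \<Rightarrow> real" where
  "power_sum n j x = (\<Sum>i<n. (x $ i) ^ j)"

definition P_feasible :: "nat \<Rightarrow> nat \<Rightarrow> (nat \<Rightarrow> real) \<Rightarrow> real vec set" where
  "P_feasible n m \<gamma> = {x \<in> carrier_vec n. \<forall>j\<in>{1..<m}. power_sum n j x = \<gamma> j}"

definition min_P :: "nat \<Rightarrow> nat \<Rightarrow> nat \<Rightarrow> (nat \<Rightarrow> real) \<Rightarrow> ereal" where
  "min_P n m q \<gamma> = opt_value (power_sum n q) (P_feasible n m \<gamma>)"

definition U_seq :: "nat \<Rightarrow> (nat \<Rightarrow> real) \<Rightarrow> real \<Rightarrow> nat \<Rightarrow> real" where
  "U_seq m \<gamma> p0 j = (if j = 0 then real m else if j < m then \<gamma> j else Q m \<gamma> j p0)"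

definition U_feasible :: "nat \<Rightarrow> (nat \<Rightarrow> real) \<Rightarrow> real set" where
  "U_feasible m \<gamma> = {p0. psd (hankel_mat m (U_seq m \<gamma> p0))}"

text \<open>The program defining \<open>U_value\<close> does not involve $n$.\<close>

definition U_value :: "nat \<Rightarrow> nat \<Rightarrow> (nat \<Rightarrow> real) \<Rightarrow> ereal" where
  "U_value m q \<gamma> = opt_value (Q m \<gamma> q) (U_feasible m \<gamma>)"

end

theory Submission
  imports Defs
begin

text \<open>
  The sequence in the semidefinite program is the full sequence of Newton sums of the polynomial
  with free constant term, so Hermite's criterion says that the Hankel matrix is positive
  semidefinite iff all roots are real.  A feasible \<open>p0\<close> thus yields \<open>m\<close> real roots, which padded
  with zeros are feasible for the original problem with the same objective value.  Conversely, an
  optimal point with at most \<open>m\<close> non-zero entries consists of the roots of such a polynomial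
  and \<open>n - m\<close> zeros.  Convexity holds because the Newton sums of order at most \<open>2m - 2\<close> are
  affine in \<open>p0\<close>.
\<close>

section \<open>Newton's identities\<close>

text \<open>Synthetic division read backwards: the coefficients of \<open>[:-x, 1:] * g\<close> are
  \<open>coeff g (l - 1) - x * coeff g l\<close>, so the weighted sum telescopes. The degree bound
  kills the boundary term at \<open>N\<close>.\<close>

lemma coeff_linear_factor_quotient:
  fixes g :: "'a::comm_ring_1 poly"
  assumes "degree g < N"
  shows "(\<Sum>l=Suc j..N. coeff ([:-x, 1:] * g) l * x ^ (l - Suc j)) = coeff g j"
proof (cases "j < N")
  case True
  have "(\<Sum>l=Suc j..M. coeff ([:-x, 1:] * g) l * x ^ (l - Suc j))
      = coeff g j - coeff g M * x ^ (M - j)" if "j \<le> M" for M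
    using that
  proof (induction M rule: dec_induct)
    case (step M)
    then show ?case by (simp add: Suc_diff_le algebra_simps)
  qed simp
  from this[of N] True assms show ?thesis by (simp add: coeff_eq_0)
next
  case False
  with assms show ?thesis by (simp add: coeff_eq_0)
qed

lemma degree_prod_linear:
  fixes y :: "nat \<Rightarrow> 'a::idom"
  shows "degree (\<Prod>i<m. [:-y i, 1:]) = m"
  by (subst degree_prod_sum_eq) auto

lemma coeff_prod_linear_top:
  fixes y :: "nat \<Rightarrow> 'a::idom"
  shows "coeff (\<Prod>i<m. [:-y i, 1:]) m = 1"
  using lead_coeff_prod[of "\<lambda>i. [:-y i, 1:]" "{..<m}"] by (simp add: degree_prod_linear)

text \<open>The coefficient of \<open>pderiv p\<close> at \<open>m - k - 1\<close> is computed
  twice: directly, and from the product rule, where each summand is \<open>p\<close> divided by one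
  linear factor and synthetic division gives its coefficients.\<close>

lemma newton_identity_low:
  fixes y :: "nat \<Rightarrow> 'a::idom" and m :: nat
  defines "p \<equiv> \<Prod>i<m. [:-y i, 1:]"
  assumes k: "k < m"
  shows "(\<Sum>i<k. coeff p (m - i) * (\<Sum>l<m. y l ^ (k - i))) = - of_nat k * coeff p (m - k)"
proof -
  define j where "j = m - Suc k"
  have j: "Suc j = m - k" using k by (simp add: j_def)
  have quotient: "coeff (\<Prod>i\<in>{..<m} - {a}. [:-y i, 1:]) j
      = (\<Sum>l=Suc j..m. coeff p l * y a ^ (l - Suc j))" if "a < m" for a
  proof -
    have p: "p = [:-y a, 1:] * (\<Prod>i\<in>{..<m} - {a}. [:-y i, 1:])"
      unfolding p_def using that by (subst prod.remove[of _ a]) auto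
    have "degree (\<Prod>i\<in>{..<m} - {a}. [:-y i, 1:]) < m"
      using that by (subst degree_prod_sum_eq) auto
    from coeff_linear_factor_quotient[OF this, where j = j and x = "y a"] show ?thesis
      by (simp only: p[symmetric])
  qed
  have "of_nat (m - k) * coeff p (m - k) = coeff (pderiv p) j"
    by (simp add: coeff_pderiv j)
  also have "pderiv p = (\<Sum>a<m. \<Prod>i\<in>{..<m} - {a}. [:-y i, 1:])"
    unfolding p_def by (subst pderiv_prod) (simp add: pderiv_pCons)
  also have "coeff \<dots> j = (\<Sum>a<m. \<Sum>l=Suc j..m. coeff p l * y a ^ (l - Suc j))"
    by (simp add: coeff_sum quotient)
  also have "\<dots> = (\<Sum>l=m-k..m. coeff p l * (\<Sum>a<m. y a ^ (l - (m - k))))"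
    unfolding j by (subst sum.swap) (simp add: sum_distrib_left)
  also have "\<dots> = (\<Sum>i\<le>k. coeff p (m - i) * (\<Sum>a<m. y a ^ (k - i)))"
    by (rule sum.reindex_bij_witness[of _ "\<lambda>i. m - i" "\<lambda>l. m - l"]) (use k in \<open>auto simp: add.commute\<close>)
  \<comment> \<open>The summand \<open>i = k\<close> contains zeroth powers, whose sum is
    \<open>m\<close>; against the factor \<open>m - k\<close> on the left this leaves
    \<open>- k\<close>.\<close>
  also have "\<dots> = (\<Sum>i<k. coeff p (m - i) * (\<Sum>a<m. y a ^ (k - i))) + of_nat m * coeff p (m - k)"
    by (simp add: lessThan_Suc_atMost[symmetric])
  finally show ?thesis
    using k by (simp add: of_nat_diff eq_neg_iff_add_eq_0 algebra_simps)
qed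

text \<open>Each root satisfies \<open>poly p (y l) = 0\<close>; multiply by
  \<open>y l ^ (k - m)\<close> and sum over the roots.\<close>

lemma newton_identity_high:
  fixes y :: "nat \<Rightarrow> 'a::idom" and m :: nat
  defines "p \<equiv> \<Prod>i<m. [:-y i, 1:]"
  assumes k: "m \<le> k"
  shows "(\<Sum>i\<le>m. coeff p (m - i) * (\<Sum>l<m. y l ^ (k - i))) = 0"
proof -
  have "(\<Sum>i\<le>m. coeff p (m - i) * (\<Sum>l<m. y l ^ (k - i)))
      = (\<Sum>i\<le>m. coeff p i * (\<Sum>l<m. y l ^ (k - m + i)))"
    by (rule sum.reindex_bij_witness[of _ "\<lambda>i. m - i" "\<lambda>i. m - i"]) (use k in auto)
  also have "\<dots> = (\<Sum>l<m. y l ^ (k - m) * (\<Sum>i\<le>m. coeff p i * y l ^ i))"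
    by (simp add: sum_distrib_left) (subst sum.swap, simp add: power_add mult_ac)
  also have "\<dots> = (\<Sum>l<m. y l ^ (k - m) * poly p (y l))"
    by (simp add: poly_altdef p_def degree_prod_linear)
  also have "\<dots> = 0"
    by (intro sum.neutral) (auto simp: p_def poly_prod)
  finally show ?thesis .
qed

section \<open>Newton sums of real polynomials\<close>

lemma map_poly_of_real_mult:
  "map_poly complex_of_real (p * q) = map_poly complex_of_real p * map_poly complex_of_real q"
  by (rule poly_eqI) (simp add: coeff_map_poly coeff_mult)

lemma map_poly_of_real_add:
  "map_poly complex_of_real (p + q) = map_poly complex_of_real p + map_poly complex_of_real q"
  by (rule poly_eqI) (simp add: coeff_map_poly)

lemma map_poly_of_real_power:
  "map_poly complex_of_real (p ^ k) = map_poly complex_of_real p ^ k"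
  by (induction k) (auto simp: map_poly_of_real_mult)

lemma map_poly_of_real_prod_linear:
  "map_poly complex_of_real (\<Prod>i<(m::nat). [:-y i, 1:]) = (\<Prod>i<m. [:-complex_of_real (y i), 1:])"
  by (induction m) (auto simp: map_poly_of_real_mult map_poly_pCons
      simp del: mult_pCons_left mult_pCons_right)

lemma newton_sum_eq:
  fixes y :: "nat \<Rightarrow> complex"
  assumes "map_poly complex_of_real p = (\<Prod>i<m. [:-y i, 1:])"
  shows "newton_sum p k = Re (\<Sum>l<m. y l ^ k)"
proof -
  have "proots (\<Prod>i<m. [:-y i, 1:]) = (\<Sum>i<m. {#y i#})"
    by (subst proots_prod) auto
  also have "\<dots> = image_mset y (mset_set {..<m})"
    by (induction m) (auto simp: lessThan_Suc)
  finally show ?thesis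
    unfolding newton_sum_def assms by (simp add: image_mset.compositionality o_def sum_unfold_sum_mset)
qed

text \<open>The fundamental theorem of algebra. Listing the roots by index keeps multiplicities and
  turns Newton sums into ordinary finite sums.\<close>

lemma newton_poly_roots:
  assumes "m \<ge> 1"
  obtains y where "map_poly complex_of_real (newton_poly m \<gamma> p0) = (\<Prod>i<m. [:-y i, 1:])"
proof -
  let ?p = "map_poly complex_of_real (newton_poly m \<gamma> p0)"
  have "degree ?p = m" "lead_coeff ?p = 1"
    using newton_poly_monic[OF assms, of \<gamma> p0] by (simp_all add: degree_map_poly coeff_map_poly)
  moreover obtain y where "Polynomial.smult (lead_coeff ?p) (\<Prod>i<degree ?p. [:-y i, 1:]) = ?p"
    by (rule complex_poly_decompose')
  ultimately have "?p = (\<Prod>i<m. [:-y i, 1:])" by simp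
  thus ?thesis by (rule that)
qed

text \<open>Newton's identities have real coefficients and determine the power sums recursively, so the
  power sums are real without an appeal to conjugate pairs.\<close>

lemma newton_poly_power_sums:
  assumes m: "m \<ge> 1"
    and y: "map_poly complex_of_real (newton_poly m \<gamma> p0) = (\<Prod>i<m. [:-y i, 1:])"
  shows "(\<Sum>l<m. y l ^ k) = complex_of_real (U_seq m \<gamma> p0 k)"
proof -
  let ?p = "newton_poly m \<gamma> p0"
  have coeff: "coeff (\<Prod>i<m. [:-y i, 1:]) i = complex_of_real (coeff ?p i)" for i
    by (simp add: y[symmetric] coeff_map_poly)
  have low: "(\<Sum>l<m. y l ^ k) = complex_of_real (U_seq m \<gamma> p0 k)" if "k < m" for k
    using that
  proof (induction k rule: less_induct)
    case (less k)
    show ?case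
    proof (cases "k = 0")
      case False
      have "- of_nat k * complex_of_real (coeff ?p (m - k))
          = (\<Sum>i<k. complex_of_real (coeff ?p (m - i)) * (\<Sum>l<m. y l ^ (k - i)))"
        using newton_identity_low[of k m y] less.prems by (simp add: coeff)
      also have "\<dots> = (\<Sum>l<m. y l ^ k)
          + (\<Sum>i=1..<k. complex_of_real (coeff ?p (m - i)) * (\<Sum>l<m. y l ^ (k - i)))"
        using False m
        by (simp add: lessThan_atLeast0 sum.atLeast_Suc_lessThan[of 0] coeff_newton_poly)
      also have "(\<Sum>i=1..<k. complex_of_real (coeff ?p (m - i)) * (\<Sum>l<m. y l ^ (k - i)))
          = complex_of_real (\<Sum>i=1..<k. coeff ?p (m - i) * \<gamma> (k - i))"
        using less by (auto simp: U_seq_def intro!: sum.cong)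
      finally have "(\<Sum>l<m. y l ^ k) = complex_of_real (- real k * coeff ?p (m - k)
          - (\<Sum>i=1..<k. coeff ?p (m - i) * \<gamma> (k - i)))"
        by simp
      with newton_poly_newton_identity[of k m \<gamma> p0] False less.prems
      show ?thesis by (simp add: U_seq_def flip: of_real_mult of_real_sum of_real_add of_real_diff)
    qed (simp add: U_seq_def)
  qed
  have real: "(\<Sum>l<m. y l ^ k) \<in> \<real>" for k
  proof (induction k rule: less_induct)
    case (less k)
    show ?case
    proof (cases "k < m")
      case False
      have "(\<Sum>i\<le>m. complex_of_real (coeff ?p (m - i)) * (\<Sum>l<m. y l ^ (k - i))) = 0"
        using newton_identity_high[of m k y] False by (simp add: coeff)
      hence "(\<Sum>l<m. y l ^ k)
          = - (\<Sum>i=1..m. complex_of_real (coeff ?p (m - i)) * (\<Sum>l<m. y l ^ (k - i)))"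
        using m by (simp add: atMost_atLeast0 sum.atLeast_Suc_atMost[of 0] coeff_newton_poly
            eq_neg_iff_add_eq_0)
      also have "\<dots> \<in> \<real>"
        using False m
        by (intro Reals_minus sum_in_Reals[of "{1..m}"] Reals_mult Reals_of_real less.IH) auto
      finally show ?thesis .
    qed (simp add: low)
  qed
  show ?thesis
  proof (cases "k < m")
    \<comment> \<open>From order \<open>m\<close> on, \<open>U_seq\<close> is by definition the real
      part of the power sum, so realness suffices.\<close>
    case False
    with real[of k] m show ?thesis
      by (auto simp: U_seq_def Q_def newton_sum_eq[OF y] complex_is_Real_iff complex_eq_iff)
  qed (simp add: low)
qed

text \<open>Newton's identities below order \<open>m\<close> can be solved for the coefficients, so
  the prescribed power sums fix every coefficient except the constant one, which is supplied as the
  free parameter.\<close>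

lemma newton_poly_eqI:
  fixes y :: "nat \<Rightarrow> real" and m :: nat
  defines "p \<equiv> \<Prod>i<m. [:-y i, 1:]"
  assumes m: "m \<ge> 1" and \<gamma>: "\<And>k. 1 \<le> k \<Longrightarrow> k < m \<Longrightarrow> (\<Sum>l<m. y l ^ k) = \<gamma> k"
  shows "newton_poly m \<gamma> (coeff p 0) = p"
proof -
  have low: "coeff p (m - k) = newton_coeff \<gamma> k" if "k < m" for k
    using that
  proof (induction k rule: less_induct)
    case (less k)
    show ?case
    proof (cases "k = 0")
      case False
      have "(\<Sum>i<k. newton_coeff \<gamma> i * \<gamma> (k - i))
          = (\<Sum>i<k. coeff p (m - i) * (\<Sum>l<m. y l ^ (k - i)))"
        using less by (intro sum.cong) (auto simp: \<gamma>)
      also have "\<dots> = - real k * coeff p (m - k)"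
        using newton_identity_low[of k m y] less.prems by (simp add: p_def)
      finally show ?thesis
        using False by (subst newton_coeff.simps) (simp add: field_simps)
    qed (simp add: newton_coeff.simps p_def coeff_prod_linear_top)
  qed
  show ?thesis
  proof (rule poly_eqI)
    fix j
    show "coeff (newton_poly m \<gamma> (coeff p 0)) j = coeff p j"
      using low[of "m - j"] m
      by (auto simp: coeff_newton_poly p_def coeff_prod_linear_top degree_prod_linear coeff_eq_0)
  qed
qed

section \<open>Hermite's criterion\<close>

lemma hankel_quadratic_form:
  "vec m v \<bullet> (hankel_mat m s *\<^sub>v vec m v) = (\<Sum>i<m. \<Sum>j<m. v i * v j * s (i + j))"
  by (auto simp: hankel_mat_def scalar_prod_def sum_distrib_left lessThan_atLeast0 mult_ac
      intro!: sum.cong)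

text \<open>Replacing carrier vectors by functions lets the coefficient sequence of a polynomial
  serve as a test vector.\<close>

lemma psd_hankel_iff:
  "psd (hankel_mat m s) \<longleftrightarrow>
    (\<forall>v. 0 \<le> (\<Sum>i<m. \<Sum>j<m. v i * v j * s (i + j)))"
proof -
  have "transpose_mat (hankel_mat m s) = hankel_mat m s"
    by (rule eq_matI) (auto simp: hankel_mat_def add.commute)
  moreover have "square_mat (hankel_mat m s)" "dim_row (hankel_mat m s) = m"
    by (auto simp: hankel_mat_def)
  ultimately have "psd (hankel_mat m s) \<longleftrightarrow>
      (\<forall>w \<in> carrier_vec m. 0 \<le> w \<bullet> (hankel_mat m s *\<^sub>v w))"
    by (simp add: psd_def)
  also have "\<dots> \<longleftrightarrow> (\<forall>v. 0 \<le> vec m v \<bullet> (hankel_mat m s *\<^sub>v vec m v))"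
  proof -
    have "\<exists>v. w = vec m v" if "w \<in> carrier_vec m" for w :: "real vec"
      using that by (intro exI[of _ "vec_index w"]) auto
    thus ?thesis by auto
  qed
  finally show ?thesis
    by (simp only: hankel_quadratic_form)
qed

text \<open>The Hankel matrix of power sums is the transposed Vandermonde matrix of the nodes times
  that matrix itself. There is no conjugation, so the right-hand side has squares of complex numbers
  rather than squared moduli; non-real nodes can make it negative.\<close>

lemma hankel_form_power_sums:
  fixes y :: "nat \<Rightarrow> complex"
  assumes "\<And>k. (\<Sum>l<m. y l ^ k) = complex_of_real (s k)"
  shows "complex_of_real (\<Sum>i<m. \<Sum>j<m. v i * v j * s (i + j))
    = (\<Sum>l<m. (\<Sum>i<m. complex_of_real (v i) * y l ^ i)\<^sup>2)"
proof -
  have "complex_of_real (\<Sum>i<m. \<Sum>j<m. v i * v j * s (i + j))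
    = (\<Sum>i<m. \<Sum>j<m. \<Sum>l<m. complex_of_real (v i) * complex_of_real (v j) * y l ^ (i + j))"
    by (simp add: assms[symmetric] sum_distrib_left)
  also have "\<dots> = (\<Sum>i<m. \<Sum>l<m. \<Sum>j<m. complex_of_real (v i) * complex_of_real (v j) * y l ^ (i + j))"
    by (intro sum.cong refl sum.swap)
  also have "\<dots> = (\<Sum>l<m. \<Sum>i<m. \<Sum>j<m. complex_of_real (v i) * complex_of_real (v j) * y l ^ (i + j))"
    by (rule sum.swap)
  also have "\<dots> = (\<Sum>l<m. (\<Sum>i<m. complex_of_real (v i) * y l ^ i)\<^sup>2)"
    by (simp add: power2_eq_square sum_product power_add mult_ac)
  finally show ?thesis .
qed

lemma psd_hankel_if_real:
  fixes y :: "nat \<Rightarrow> real"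
  assumes "\<And>k. (\<Sum>l<m. y l ^ k) = s k"
  shows "psd (hankel_mat m s)"
  unfolding psd_hankel_iff
proof
  fix v :: "nat \<Rightarrow> real"
  have "complex_of_real (\<Sum>i<m. \<Sum>j<m. v i * v j * s (i + j))
      = (\<Sum>l<m. (\<Sum>i<m. complex_of_real (v i) * complex_of_real (y l) ^ i)\<^sup>2)"
    by (rule hankel_form_power_sums) (simp add: assms[symmetric])
  also have "\<dots> = complex_of_real (\<Sum>l<m. (\<Sum>i<m. v i * y l ^ i)\<^sup>2)"
    by simp
  finally show "0 \<le> (\<Sum>i<m. \<Sum>j<m. v i * v j * s (i + j))"
    by (simp only: of_real_eq_iff) (simp add: sum_nonneg)
qed

section \<open>Separating a non-real root by a real polynomial\<close>

lemma cmod_mult_self: "cmod z * cmod z = Re z * Re z + Im z * Im z"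
  using cmod_power2[of z] by (simp only: power2_eq_square)

text \<open>Here \<open>r\<close> is the minimal polynomial of \<open>z\<close> over the reals: the
  remainder of \<open>g\<close> modulo \<open>r\<close> is real, has degree at most 1 and vanishes
  at the non-real point \<open>z\<close>, hence is zero.\<close>

lemma real_quadratic_dvd:
  fixes g :: "real poly"
  assumes z: "Im z \<noteq> 0" and g: "poly (map_poly complex_of_real g) z = 0"
  defines "r \<equiv> [:(cmod z)\<^sup>2, - 2 * Re z, 1:]"
  shows "r dvd g"
proof -
  have r0: "poly (map_poly complex_of_real r) z = 0"
    by (simp add: r_def map_poly_pCons complex_eq_iff cmod_mult_self power2_eq_square algebra_simps)
  define h where "h = g mod r"
  have "degree h < 2"
    using degree_mod_less'[of r g] by (cases "h = 0") (auto simp: h_def r_def)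
  then obtain a b where h: "h = [:a, b:]"
    by (metis degree_pCons_eq degree_eq_zeroE less_2_cases Suc_less_eq less_one numeral_2_eq_2
        pCons_cases pCons_0_0 less_Suc_eq_0_disj not_less_zero)
  have "g = r * (g div r) + h" by (simp add: h_def)
  hence "poly (map_poly complex_of_real g) z = poly (map_poly complex_of_real h) z"
    by (metis map_poly_of_real_add map_poly_of_real_mult poly_add poly_mult r0 mult_zero_left add_0)
  hence "complex_of_real a + z * complex_of_real b = 0"
    using g by (simp add: h map_poly_pCons)
  hence "b = 0" "a = 0" using z by (auto simp: complex_eq_iff)
  hence "h = 0" by (simp add: h)
  thus ?thesis by (simp add: h_def mod_eq_0_iff_dvd)
qed

text \<open>Splits off the full multiplicity of \<open>r\<close>. A non-real root may be multiple,
  and the cofactor must not vanish there.\<close>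

lemma poly_power_factor:
  fixes p r :: "'a::field poly"
  assumes "p \<noteq> 0" "degree r > 0"
  obtains k g where "p = r ^ k * g" "\<not> r dvd g"
proof -
  have "\<exists>k g. p = r ^ k * g \<and> \<not> r dvd g"
    using assms(1)
  proof (induction "degree p" arbitrary: p rule: less_induct)
    case less
    show ?case
    proof (cases "r dvd p")
      case True
      then obtain p' where p': "p = r * p'" by (elim dvdE)
      with less.prems have "degree p = degree r + degree p'" "p' \<noteq> 0"
        by (auto simp: degree_mult_eq)
      with less.hyps[of p'] assms(2) obtain k g where "p' = r ^ k * g" "\<not> r dvd g" by auto
      thus ?thesis by (intro exI[of _ "Suc k"] exI[of _ g]) (simp add: p' mult.assoc)
    next
      case False
      thus ?thesis by (intro exI[of _ 0] exI[of _ p]) simp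
    qed
  qed
  thus ?thesis using that by blast
qed

text \<open>At a non-real root the interpolating polynomial takes the value \<open>\<i>\<close>, at its conjugate \<open>-\<i>\<close>;
  the squares of both are \<open>-1\<close>.\<close>

lemma nonreal_root_separating_poly:
  fixes p :: "real poly"
  assumes p: "p \<noteq> 0" and z: "poly (map_poly complex_of_real p) z = 0" "Im z \<noteq> 0"
  obtains f where "degree f < degree p" "poly (map_poly complex_of_real f) z = \<i>"
    "\<And>x. poly (map_poly complex_of_real p) x = 0 \<Longrightarrow>
      (poly (map_poly complex_of_real f) x)\<^sup>2 \<in> {0, -1}"
proof -
  define r where "r = [:(cmod z)\<^sup>2, - 2 * Re z, 1:]"
  have "degree r = 2" by (simp add: r_def)
  then obtain k g where g: "p = r ^ k * g" "\<not> r dvd g"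
    using poly_power_factor[OF p, of r] by auto
  have "r dvd p" using real_quadratic_dvd[OF z(2,1)] by (simp add: r_def)
  hence "k > 0" using g by (cases k) auto
  have gz: "poly (map_poly complex_of_real g) z \<noteq> 0"
    using g(2) real_quadratic_dvd[OF z(2)] by (auto simp: r_def)
  have "degree p = 2 * k + degree g"
    using p g(1) \<open>degree r = 2\<close> by (auto simp: degree_mult_eq degree_power_eq)
  \<comment> \<open>The linear factor \<open>[:a, b:]\<close> must take the value \<open>w\<close>
    at \<open>z\<close> for the product with \<open>g\<close> to be \<open>\<i>\<close> there. Real
    \<open>a\<close> and \<open>b\<close> exist because \<open>1\<close> and \<open>z\<close> span
    the complex numbers over the reals.\<close>
  define w where "w = \<i> / poly (map_poly complex_of_real g) z"
  define b where "b = Im w / Im z"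
  define a where "a = Re w - b * Re z"
  have w: "complex_of_real a + z * complex_of_real b = w"
    using z(2) by (simp add: a_def b_def complex_eq_iff)
  define f where "f = g * [:a, b:]"
  have "degree f \<le> degree g + 1"
    unfolding f_def by (rule order.trans[OF degree_mult_le]) auto
  \<comment> \<open>Replacing \<open>r ^ k\<close> with \<open>k \<ge> 1\<close> by a linear factor
    lowers the degree by at least one.\<close>
  hence deg: "degree f < degree p"
    using \<open>degree p = _\<close> \<open>k > 0\<close> by simp
  have fz: "poly (map_poly complex_of_real f) z = \<i>"
    using gz w by (simp add: f_def map_poly_of_real_mult map_poly_pCons w_def del: mult_pCons_right)
  have "poly (map_poly complex_of_real f) (cnj z) = cnj (poly (map_poly complex_of_real f) z)"
    by (rule poly_cnj_real[symmetric]) (simp add: coeff_map_poly)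
  hence fz': "poly (map_poly complex_of_real f) (cnj z) = - \<i>" by (simp add: fz)
  show ?thesis
  proof (rule that[OF deg fz])
    fix x assume "poly (map_poly complex_of_real p) x = 0"
    hence "poly (map_poly complex_of_real r) x ^ k * poly (map_poly complex_of_real g) x = 0"
      by (subst (asm) g(1)) (simp add: map_poly_of_real_mult map_poly_of_real_power)
    then consider "poly (map_poly complex_of_real r) x = 0" | "poly (map_poly complex_of_real g) x = 0"
      by auto
    thus "(poly (map_poly complex_of_real f) x)\<^sup>2 \<in> {0, -1}"
    proof cases
      case 1
      have "poly (map_poly complex_of_real r) x = (x - z) * (x - cnj z)"
        by (simp add: r_def map_poly_pCons complex_eq_iff cmod_mult_self power2_eq_square algebra_simps)
      with 1 have "x = z \<or> x = cnj z" by simp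
      thus ?thesis by (auto simp: fz fz')
    next
      case 2
      thus ?thesis by (simp add: f_def map_poly_of_real_mult del: mult_pCons_right)
    qed
  qed
qed

text \<open>If some root were non-real, the coefficients of the separating polynomial
  \<open>f\<close> would be a test vector violating semidefiniteness: the form equals the sum of the
  squares of \<open>f\<close> at the roots, each 0 or -1, with -1 at \<open>y a\<close>.\<close>

lemma real_roots_if_psd_hankel:
  fixes y :: "nat \<Rightarrow> complex"
  assumes p: "map_poly complex_of_real p = (\<Prod>i<m. [:-y i, 1:])"
    and s: "\<And>k. (\<Sum>l<m. y l ^ k) = complex_of_real (s k)"
    and psd: "psd (hankel_mat m s)" and a: "a < m"
  shows "Im (y a) = 0"
proof (rule ccontr)
  assume nonreal: "Im (y a) \<noteq> 0"
  have root: "poly (map_poly complex_of_real p) (y l) = 0" if "l < m" for l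
    using that by (auto simp: p poly_prod)
  have deg: "degree p = m"
    using arg_cong[OF p, of degree] by (simp add: degree_prod_linear degree_map_poly)
  with a have "p \<noteq> 0" by auto
  then obtain f where f: "degree f < m" "poly (map_poly complex_of_real f) (y a) = \<i>"
    "\<And>x. poly (map_poly complex_of_real p) x = 0 \<Longrightarrow>
      (poly (map_poly complex_of_real f) x)\<^sup>2 \<in> {0, -1}"
    using nonreal_root_separating_poly[OF _ root[OF a] nonreal] deg by metis
  \<comment> \<open>As \<open>degree f < m\<close>, the coefficients fit into a vector of length
    \<open>m\<close>, padded with zeros.\<close>
  have eval: "poly (map_poly complex_of_real f) x = (\<Sum>i<m. complex_of_real (coeff f i) * x ^ i)" for x
  proof -
    have "poly (map_poly complex_of_real f) x = (\<Sum>i\<le>degree f. complex_of_real (coeff f i) * x ^ i)"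
      by (simp add: poly_altdef coeff_map_poly degree_map_poly)
    also have "\<dots> = (\<Sum>i<m. complex_of_real (coeff f i) * x ^ i)"
      by (rule sum.mono_neutral_left) (use f(1) in \<open>auto simp: coeff_eq_0\<close>)
    finally show ?thesis .
  qed
  have "(\<Sum>i<m. \<Sum>j<m. coeff f i * coeff f j * s (i + j))
      = Re (\<Sum>l<m. (poly (map_poly complex_of_real f) (y l))\<^sup>2)"
    by (simp only: eval hankel_form_power_sums[OF s, symmetric] Re_complex_of_real)
  also have "\<dots> = (\<Sum>l<m. Re ((poly (map_poly complex_of_real f) (y l))\<^sup>2))"
    by simp
  also have "\<dots> < (\<Sum>l<m. 0)"
  proof (rule sum_strict_mono_ex1)
    show "\<forall>l\<in>{..<m}. Re ((poly (map_poly complex_of_real f) (y l))\<^sup>2) \<le> 0"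
      using f(3)[OF root] by fastforce
    show "\<exists>l\<in>{..<m}. Re ((poly (map_poly complex_of_real f) (y l))\<^sup>2) < 0"
      using a f(2) by (intro bexI[of _ a]) auto
  qed simp
  finally have "(\<Sum>i<m. \<Sum>j<m. coeff f i * coeff f j * s (i + j)) < 0" by simp
  moreover have "0 \<le> (\<Sum>i<m. \<Sum>j<m. coeff f i * coeff f j * s (i + j))"
    using psd unfolding psd_hankel_iff by (rule spec)
  ultimately show False by simp
qed

section \<open>Comparison of the two problems\<close>

text \<open>Semidefiniteness makes all \<open>m\<close> roots real, and \<open>n - m\<close>
  additional zeros change no power sum of positive order.\<close>

lemma P_feasible_if_U_feasible:
  assumes m: "1 \<le> m" "m \<le> n" and q: "m \<le> q" and p0: "p0 \<in> U_feasible m \<gamma>"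
  obtains x where "x \<in> P_feasible n m \<gamma>" "power_sum n q x = Q m \<gamma> q p0"
proof -
  obtain y where y: "map_poly complex_of_real (newton_poly m \<gamma> p0) = (\<Prod>i<m. [:-y i, 1:])"
    by (rule newton_poly_roots[OF m(1)])
  note s = newton_poly_power_sums[OF m(1) y]
  have real: "Im (y a) = 0" if "a < m" for a
    using real_roots_if_psd_hankel[OF y s _ that] p0 by (simp add: U_feasible_def)
  define x where "x = vec n (\<lambda>i. if i < m then Re (y i) else 0)"
  have x_y: "complex_of_real (x $ i) = y i" if "i < m" for i
    using real[OF that] m that by (simp add: x_def complex_eq_iff)
  \<comment> \<open>Order 0 is excluded since \<open>0 ^ 0 = 1\<close>: the padding zeros would
    count, giving \<open>n\<close> instead of \<open>m\<close>.\<close>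
  have x: "power_sum n k x = U_seq m \<gamma> p0 k" if "k \<ge> 1" for k
  proof -
    have "power_sum n k x = (\<Sum>i<m. (x $ i) ^ k)"
      unfolding power_sum_def
      by (rule sum.mono_neutral_right) (use m that in \<open>auto simp: x_def\<close>)
    also have "complex_of_real \<dots> = (\<Sum>i<m. y i ^ k)"
      by (simp add: x_y)
    finally show ?thesis by (simp only: s of_real_eq_iff)
  qed
  show ?thesis
    by (rule that[of x]) (use x m q in \<open>auto simp: P_feasible_def U_seq_def x_def\<close>)
qed

lemma U_feasible_if_P_feasible:
  fixes x :: "real vec"
  assumes m: "1 \<le> m" "m \<le> n" and q: "m \<le> q" and x: "x \<in> P_feasible n m \<gamma>"
    and card: "card {i. i < n \<and> x $ i \<noteq> 0} \<le> m"
  obtains p0 where "p0 \<in> U_feasible m \<gamma>" "Q m \<gamma> q p0 = power_sum n q x"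
proof -
  \<comment> \<open>The support may have fewer than \<open>m\<close> elements. Enlarging it by
    indices of zero entries gives exactly \<open>m\<close> roots, hence a polynomial of degree
    \<open>m\<close>; this is possible since \<open>m \<le> n\<close>.\<close>
  have "\<exists>B. {i. i < n \<and> x $ i \<noteq> 0} \<subseteq> B \<and> B \<subseteq> {..<n} \<and> card B = m"
    by (rule exists_subset_between[OF card]) (use m in auto)
  then obtain B where B: "{i. i < n \<and> x $ i \<noteq> 0} \<subseteq> B" "B \<subseteq> {..<n}" "card B = m"
    by blast
  have "finite B" using B(2) finite_subset by blast
  then obtain h where h: "bij_betw h {..<m} B"
    using ex_bij_betw_nat_finite[of B] B(3) by (auto simp: atLeast0LessThan)
  define y where "y = (\<lambda>l. x $ h l)"
  have sum_y: "(\<Sum>l<m. y l ^ k) = power_sum n k x" if "k \<ge> 1" for k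
  proof -
    have "(\<Sum>l<m. y l ^ k) = (\<Sum>i\<in>B. (x $ i) ^ k)"
      unfolding y_def by (rule sum.reindex_bij_betw[OF h])
    also have "\<dots> = power_sum n k x"
      unfolding power_sum_def
      by (rule sum.mono_neutral_left) (use B that in auto)
    finally show ?thesis .
  qed
  \<comment> \<open>The constant coefficient of the monic polynomial whose roots are the selected
    entries.\<close>
  define p0 where "p0 = coeff (\<Prod>i<m. [:-y i, 1:]) 0"
  have "newton_poly m \<gamma> p0 = (\<Prod>i<m. [:-y i, 1:])"
    unfolding p0_def using x by (intro newton_poly_eqI m) (auto simp: sum_y P_feasible_def)
  hence "map_poly complex_of_real (newton_poly m \<gamma> p0) = (\<Prod>i<m. [:-complex_of_real (y i), 1:])"
    by (simp only: map_poly_of_real_prod_linear)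
  from newton_poly_power_sums[OF m(1) this] have s: "(\<Sum>l<m. y l ^ k) = U_seq m \<gamma> p0 k" for k
    by (simp flip: of_real_power of_real_sum)
  show ?thesis
  proof (rule that)
    show "p0 \<in> U_feasible m \<gamma>"
      unfolding U_feasible_def using psd_hankel_if_real[OF s] by simp
    show "Q m \<gamma> q p0 = power_sum n q x"
      using s[of q] sum_y[of q] m q by (simp add: U_seq_def)
  qed
qed

section \<open>Convexity\<close>

text \<open>Newton's identity solved for its highest term, with the constant coefficient split off:
  it alone varies with the parameter, the others being determined by
  \<open>\<gamma>\<close>.\<close>

lemma U_seq_newton_identity:
  assumes "1 \<le> m" "m \<le> k"
  shows "U_seq m \<gamma> p0 k
    = - (\<Sum>i=1..<m. newton_coeff \<gamma> i * U_seq m \<gamma> p0 (k - i)) - p0 * U_seq m \<gamma> p0 (k - m)"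
proof -
  let ?p = "newton_poly m \<gamma> p0"
  obtain y where y: "map_poly complex_of_real ?p = (\<Prod>i<m. [:-y i, 1:])"
    by (rule newton_poly_roots[OF assms(1)])
  have "complex_of_real (\<Sum>i\<le>m. coeff ?p (m - i) * U_seq m \<gamma> p0 (k - i)) = 0"
    using newton_identity_high[OF assms(2), of y]
    by (simp add: y[symmetric] coeff_map_poly newton_poly_power_sums[OF assms(1) y])
  hence "0 = (\<Sum>i\<le>m. coeff ?p (m - i) * U_seq m \<gamma> p0 (k - i))"
    by (simp only: of_real_eq_0_iff)
  also have "\<dots> = U_seq m \<gamma> p0 k + (\<Sum>i=1..<m. coeff ?p (m - i) * U_seq m \<gamma> p0 (k - i))
      + p0 * U_seq m \<gamma> p0 (k - m)"
    using assms
    by (simp add: lessThan_Suc_atMost[symmetric] lessThan_atLeast0 sum.atLeast_Suc_lessThan[of 0]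
        coeff_newton_poly)
  also have "(\<Sum>i=1..<m. coeff ?p (m - i) * U_seq m \<gamma> p0 (k - i))
      = (\<Sum>i=1..<m. newton_coeff \<gamma> i * U_seq m \<gamma> p0 (k - i))"
    using assms(1) by (intro sum.cong) (auto simp: coeff_newton_poly)
  finally show ?thesis by simp
qed

text \<open>In the recursion \<open>p0\<close> multiplies only the term of order
  \<open>k - m\<close>. Since \<open>k < 2 * m\<close>, that order is below \<open>m\<close>, so the
  term does not depend on \<open>p0\<close> and no quadratic term arises; the other terms are affine
  by induction.\<close>

lemma U_seq_affine:
  assumes m: "1 \<le> m" and k: "k < 2 * m"
  shows "\<exists>a b. \<forall>p0. U_seq m \<gamma> p0 k = a + b * p0"
  using k
proof (induction k rule: less_induct)
  case (less k)
  show ?case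
  proof (cases "k < m")
    case True
    thus ?thesis
      by (intro exI[of _ "U_seq m \<gamma> 0 k"] exI[of _ 0]) (simp add: U_seq_def)
  next
    case False
    have "\<forall>i\<in>{1..<m}. \<exists>a b. \<forall>p0. U_seq m \<gamma> p0 (k - i) = a + b * p0"
    proof
      fix i assume "i \<in> {1..<m}"
      with False less.prems have "k - i < k" "k - i < 2 * m" by auto
      thus "\<exists>a b. \<forall>p0. U_seq m \<gamma> p0 (k - i) = a + b * p0" by (rule less.IH)
    qed
    from bchoice[OF this] obtain a where
      "\<forall>i\<in>{1..<m}. \<exists>b. \<forall>p0. U_seq m \<gamma> p0 (k - i) = a i + b * p0" ..
    from bchoice[OF this] obtain b where
      ab: "\<forall>i\<in>{1..<m}. \<forall>p0. U_seq m \<gamma> p0 (k - i) = a i + b i * p0" ..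
    define c where "c = U_seq m \<gamma> 0 (k - m)"
    have c: "U_seq m \<gamma> p0 (k - m) = c" for p0
      using less.prems False by (auto simp: c_def U_seq_def)
    have "U_seq m \<gamma> p0 k = - (\<Sum>i=1..<m. newton_coeff \<gamma> i * a i)
        + (- (\<Sum>i=1..<m. newton_coeff \<gamma> i * b i) - c) * p0" for p0
    proof -
      have "newton_coeff \<gamma> i * U_seq m \<gamma> p0 (k - i)
          = newton_coeff \<gamma> i * a i + newton_coeff \<gamma> i * b i * p0" if "i \<in> {1..<m}" for i
        using ab[rule_format, OF that] by (simp only: distrib_left mult.assoc)
      hence "(\<Sum>i=1..<m. newton_coeff \<gamma> i * U_seq m \<gamma> p0 (k - i))
          = (\<Sum>i=1..<m. newton_coeff \<gamma> i * a i) + (\<Sum>i=1..<m. newton_coeff \<gamma> i * b i) * p0"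
        by (simp add: sum_distrib_right sum.distrib)
      thus ?thesis
        using False m by (subst U_seq_newton_identity) (auto simp: c algebra_simps)
    qed
    thus ?thesis by blast
  qed
qed

lemma U_seq_convex_combination:
  assumes "1 \<le> m" "k < 2 * m" "u + v = 1"
  shows "U_seq m \<gamma> (u * p + v * p') k = u * U_seq m \<gamma> p k + v * U_seq m \<gamma> p' k"
proof -
  obtain a b where ab: "\<And>p0. U_seq m \<gamma> p0 k = a + b * p0"
    using U_seq_affine[OF assms(1,2)] by blast
  have v: "v = 1 - u" using assms(3) by simp
  show ?thesis by (simp add: ab v algebra_simps)
qed

text \<open>For a fixed test vector the Hankel form is affine in the parameter, because its orders
  \<open>i + j\<close> stay below \<open>2 * m\<close>. The feasible set is thus cut out by affine
  inequalities, one for each vector.\<close>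

lemma convex_U_feasible:
  assumes m: "1 \<le> m"
  shows "convex (U_feasible m \<gamma>)"
proof (rule convexI)
  fix p p' u v :: real
  assume feas: "p \<in> U_feasible m \<gamma>" "p' \<in> U_feasible m \<gamma>" and uv: "0 \<le> u" "0 \<le> v" "u + v = 1"
  define form where "form = (\<lambda>p (w :: nat \<Rightarrow> real). \<Sum>i<m. \<Sum>j<m. w i * w j * U_seq m \<gamma> p (i + j))"
  have summand: "w i * w j * U_seq m \<gamma> (u * p + v * p') (i + j)
      = u * (w i * w j * U_seq m \<gamma> p (i + j)) + v * (w i * w j * U_seq m \<gamma> p' (i + j))"
    if "i < m" "j < m" for w :: "nat \<Rightarrow> real" and i j
  proof -
    have "i + j < 2 * m" using that by simp
    from U_seq_convex_combination[OF m this uv(3)] show ?thesis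
      by (simp only: distrib_left mult.left_commute)
  qed
  have "form (u * p + v * p') w = u * form p w + v * form p' w" for w
    unfolding form_def sum_distrib_left sum.distrib[symmetric]
    by (intro sum.cong refl summand) simp_all
  moreover have feasible_iff: "p \<in> U_feasible m \<gamma> \<longleftrightarrow> (\<forall>w. 0 \<le> form p w)" for p
    by (simp add: U_feasible_def psd_hankel_iff form_def)
  ultimately show "u *\<^sub>R p + v *\<^sub>R p' \<in> U_feasible m \<gamma>"
    using feas uv by (simp add: feasible_iff)
qed

lemma convex_on_Q:
  assumes m: "1 \<le> m" and q: "m \<le> q" "q < 2 * m"
  shows "convex_on (U_feasible m \<gamma>) (Q m \<gamma> q)"
proof -
  have Q: "Q m \<gamma> q p0 = U_seq m \<gamma> p0 q" for p0
    using m q by (simp add: U_seq_def)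
  show ?thesis
    unfolding convex_on_def using m q
    by (simp add: convex_U_feasible Q U_seq_convex_combination)
qed

text \<open>The equivalent convex formulation is expressed as equality of the values together with
  convexity of the feasible set and of the objective on it. If the semidefinite program is
  infeasible, its value is \<open>\<infinity>\<close> and the inequality is trivial.\<close>

theorem theorem6p7:
  fixes n m q :: nat and \<gamma> :: "nat \<Rightarrow> real"
  assumes "m \<le> n" and "m \<le> q" and "q + 2 \<le> 2 * m"
  shows "min_P n m q \<gamma> \<le> U_value m q \<gamma> \<and>
    ((\<exists>x. is_optimal_solution (power_sum n q) (P_feasible n m \<gamma>) x \<and>
          card {i. i < n \<and> x $ i \<noteq> 0} \<le> m) \<longrightarrow>
      min_P n m q \<gamma> = U_value m q \<gamma> \<and>
      convex (U_feasible m \<gamma>) \<and> convex_on (U_feasible m \<gamma>) (Q m \<gamma> q))"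
proof -
  \<comment> \<open>The bounds \<open>m \<le> q\<close> and \<open>q + 2 \<le> 2 * m\<close> even
    force \<open>m \<ge> 2\<close>.\<close>
  have m: "1 \<le> m" and q: "q < 2 * m" using assms by auto
  have le: "min_P n m q \<gamma> \<le> U_value m q \<gamma>"
    unfolding min_P_def U_value_def opt_value_def
  proof (rule INF_mono)
    fix p0 assume "p0 \<in> U_feasible m \<gamma>"
    then obtain x where "x \<in> P_feasible n m \<gamma>" "power_sum n q x = Q m \<gamma> q p0"
      using P_feasible_if_U_feasible[OF m assms(1,2)] by blast
    thus "\<exists>x\<in>P_feasible n m \<gamma>. ereal (power_sum n q x) \<le> ereal (Q m \<gamma> q p0)"
      by (intro bexI[of _ x]) auto
  qed
  have ge: "U_value m q \<gamma> \<le> min_P n m q \<gamma>"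
    if opt: "is_optimal_solution (power_sum n q) (P_feasible n m \<gamma>) x"
      and card: "card {i. i < n \<and> x $ i \<noteq> 0} \<le> m" for x :: "real vec"
  proof -
    obtain p0 where p0: "p0 \<in> U_feasible m \<gamma>" "Q m \<gamma> q p0 = power_sum n q x"
      using U_feasible_if_P_feasible[OF m assms(1,2) _ card] opt
      unfolding is_optimal_solution_def by blast
    \<comment> \<open>The sparse optimal point becomes a feasible \<open>p0\<close> with the same
      objective value; optimality then bounds that value by \<open>min_P\<close>.\<close>
    have "U_value m q \<gamma> \<le> ereal (power_sum n q x)"
      unfolding U_value_def opt_value_def p0(2)[symmetric] by (rule INF_lower) (rule p0)
    also have "\<dots> \<le> min_P n m q \<gamma>"
      unfolding min_P_def opt_value_def
      using opt by (intro INF_greatest) (auto simp: is_optimal_solution_def)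
    finally show ?thesis .
  qed
  show ?thesis
    using le ge convex_U_feasible[OF m] convex_on_Q[OF m assms(2) q]
    by (auto intro: antisym)
qed

end
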